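(* Let $\mathbf{X}$ be a finite set of variables and let $\phi(\mathbf{X})$ be an information inequality of the form $$c_1h(\mathbf{X}_1)+\dots+c_nh(\mathbf{X}_n)\geq d_1h(\mathbf{Y}_1)+\dots+d_mh(\mathbf{Y}_m)\qquad(c_i,d_i>0),$$ where $\mathbf{X}_i,\mathbf{Y}_i\subseteq\mathbf{X}$ and each $\mathbf{Y}_i$ is a singleton set. Then $\phi$ is valid over step functions over $\mathbf{X}$ if and only if it is valid over monotone functions over $\mathbf{X}$.
   Context: A set function over a finite variable set $\mathbf{X}$ is a function $h:2^{\mathbf{X}}\to\mathbb{R}$ with $h(\emptyset)=0$. It is a monotone function if moreover $h(\mathbf{Y}\cup\mathbf{Z})\geq h(\mathbf{Y})$ for all $\mathbf{Y},\mathbf{Z}\subseteq\mathbf{X}$. For $\mathbf{U}\subseteq\mathbf{X}$, the step function $s_{\mathbf{U}}$ is the set function with $s_{\mathbf{U}}(\mathbf{W})=0$ if $\mathbf{W}\subseteq\mathbf{U}$ and $s_{\mathbf{U}}(\mathbf{W})=1$ otherwise. The coefficients $c_i,d_i$ are reals. An inequality is valid over a class of set functions if it holds for all $h$ in the class. The notation $\phi(\mathbf{X})$ indicates that $\mathbf{X}$ is the set of variables of $\phi$. *)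

theory Defs
  imports Complex_Main
begin

text \<open>
  A real-valued function on the subsets of \<open>X\<close> is represented by a total function of type
  \<open>'a set \<Rightarrow> real\<close>. Only its values on \<^term>\<open>Pow X\<close> matter; its values elsewhere are
  unconstrained in all of the following classes.
\<close>

definition set_functions :: "'a set \<Rightarrow> ('a set \<Rightarrow> real) set" where
  "set_functions X = {h. h {} = 0}"

definition monotone_functions :: "'a set \<Rightarrow> ('a set \<Rightarrow> real) set" where
  "monotone_functions X =
     {h \<in> set_functions X. \<forall>Y Z. Y \<subseteq> X \<longrightarrow> Z \<subseteq> X \<longrightarrow> h (Y \<union> Z) \<ge> h Y}"

definition is_step_function :: "'a set \<Rightarrow> 'a set \<Rightarrow> ('a set \<Rightarrow> real) \<Rightarrow> bool" where
  "is_step_function X U h \<longleftrightarrow> (\<forall>W. W \<subseteq> X \<longrightarrow> h W = (if W \<subseteq> U then 0 else 1))"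

definition step_functions :: "'a set \<Rightarrow> ('a set \<Rightarrow> real) set" where
  "step_functions X = {h. \<exists>U. U \<subseteq> X \<and> is_step_function X U h}"

definition information_inequality ::
  "nat \<Rightarrow> (nat \<Rightarrow> real) \<Rightarrow> (nat \<Rightarrow> 'a set) \<Rightarrow> nat \<Rightarrow> (nat \<Rightarrow> real) \<Rightarrow> (nat \<Rightarrow> 'a set) \<Rightarrow>
   ('a set \<Rightarrow> real) \<Rightarrow> bool" where
  "information_inequality n c A m d B h \<longleftrightarrow>
     (\<Sum>i=1..n. c i * h (A i)) \<ge> (\<Sum>j=1..m. d j * h (B j))"

definition valid_over ::
  "('a set \<Rightarrow> real) set \<Rightarrow> (('a set \<Rightarrow> real) \<Rightarrow> bool) \<Rightarrow> bool" where
  "valid_over K \<phi> \<longleftrightarrow> (\<forall>h\<in>K. \<phi> h)"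

end

theory Submission
  imports Defs
begin

text \<open>
  A singleton inequality only uses that \<open>h\<close> is nonnegative and dominates its values on singletons.
  Let \<open>U\<close> be the set of points where such an \<open>h\<close> vanishes and \<open>e\<close> the least positive value of
  \<open>h\<close> on singletons. Then \<open>h - e * s_U\<close> has the same two properties and vanishes at more points of \<open>X\<close>,
  so \<open>h\<close> is peeled down, step function by step function, to a function vanishing on all singletons,
  for which the inequality is trivial. Monotonicity itself would not survive this peeling, which is
  why the induction runs over the larger class.
\<close>

definition singleton_dominating :: "'a set \<Rightarrow> ('a set \<Rightarrow> real) \<Rightarrow> bool" where
  "singleton_dominating X h \<longleftrightarrow> (\<forall>W\<subseteq>X. h W \<ge> 0 \<and> (\<forall>x\<in>W. h {x} \<le> h W))"

lemma monotone_imp_singleton_dominating: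
  assumes "h \<in> monotone_functions X"
  shows "singleton_dominating X h"
  unfolding singleton_dominating_def
proof (intro allI impI conjI ballI)
  have mono: "h Y \<le> h (Y \<union> Z)" if "Y \<subseteq> X" "Z \<subseteq> X" for Y Z
    using assms that by (auto simp: monotone_functions_def)
  have empty: "h {} = 0"
    using assms by (auto simp: monotone_functions_def set_functions_def)
  fix W assume W: "W \<subseteq> X"
  show "h W \<ge> 0"
    using mono[of "{}" W] W empty by simp
  fix x assume "x \<in> W"
  then show "h {x} \<le> h W"
    using mono[of "{x}" W] W by (auto simp: insert_absorb)
qed

text \<open>A set not contained in \<open>U\<close> stays so when enlarged. This inclusion gives the
  easy direction of the equivalence.\<close>

lemma step_functions_subset_monotone: "step_functions X \<subseteq> monotone_functions X"
proof
  fix h assume "h \<in> step_functions X"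
  then obtain U where "\<And>W. W \<subseteq> X \<Longrightarrow> h W = (if W \<subseteq> U then 0 else 1)"
    by (auto simp: step_functions_def is_step_function_def)
  then show "h \<in> monotone_functions X"
    by (simp add: monotone_functions_def set_functions_def)
qed

lemma step_function_in_step_functions:
  "U \<subseteq> X \<Longrightarrow> (\<lambda>W. if W \<subseteq> U then 0 else 1) \<in> step_functions X"
  by (auto simp: step_functions_def is_step_function_def)

text \<open>Both sides are linear in the set function, so the solutions form a convex cone. This
  reassembles a peeled function and the step function taken off it.\<close>

lemma information_inequality_add_scale:
  assumes "information_inequality n c A m d B f" "information_inequality n c A m d B g" "e \<ge> 0"
  shows "information_inequality n c A m d B (\<lambda>W. f W + e * g W)"
proof -
  have "e * (\<Sum>j=1..m. d j * g (B j)) \<le> e * (\<Sum>i=1..n. c i * g (A i))"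
    using assms(2,3) by (simp add: information_inequality_def mult_left_mono)
  then show ?thesis
    using assms(1)
    by (simp add: information_inequality_def algebra_simps sum.distrib sum_distrib_left)
qed

text \<open>The amount \<open>e\<close> is taken off only where \<open>W\<close> contains a point
  outside \<open>U\<close>, and the value of \<open>h\<close> at that point, hence
  \<open>h W\<close>, is at least \<open>e\<close>.\<close>

lemma singleton_dominating_peel:
  assumes dom: "singleton_dominating X h"
    and U: "U = {x \<in> X. h {x} = 0}"
    and e: "\<And>x. x \<in> X - U \<Longrightarrow> e \<le> h {x}"
  shows "singleton_dominating X (\<lambda>W. h W - e * (if W \<subseteq> U then 0 else 1))"
  unfolding singleton_dominating_def
proof (intro allI impI)
  fix W assume W: "W \<subseteq> X"
  have h: "h W \<ge> 0" "\<And>x. x \<in> W \<Longrightarrow> h {x} \<le> h W"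
    using dom W by (auto simp: singleton_dominating_def)
  have "e \<le> h W" if not_sub: "\<not> W \<subseteq> U"
  proof -
    obtain x where "x \<in> W" "x \<in> X - U" using not_sub W by blast
    then show ?thesis using e h(2) by force
  qed
  \<comment> \<open>When \<open>W\<close> is not inside \<open>U\<close>, a point \<open>x\<close>
    outside \<open>U\<close> loses \<open>e\<close> on both sides; for \<open>x\<close> in
    \<open>U\<close> the left side is 0 and the right side is nonnegative.\<close>
  then show "h W - e * (if W \<subseteq> U then 0 else 1) \<ge> 0 \<and>
      (\<forall>x\<in>W. h {x} - e * (if {x} \<subseteq> U then 0 else 1) \<le> h W - e * (if W \<subseteq> U then 0 else 1))"
    using h W by (auto simp: U)
qed

text \<open>Strong induction on the number of points \<open>x\<close> of \<open>X\<close> with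
  \<open>h {x}\<close> nonzero; each peeling lowers it.\<close>

lemma information_inequality_singleton_dominating:
  assumes "finite X"
    and c: "\<And>i. i \<in> {1..n} \<Longrightarrow> c i \<ge> 0"
    and A: "\<And>i. i \<in> {1..n} \<Longrightarrow> A i \<subseteq> X"
    and B: "\<And>j. j \<in> {1..m} \<Longrightarrow> B j \<subseteq> X" "\<And>j. j \<in> {1..m} \<Longrightarrow> is_singleton (B j)"
    and valid: "valid_over (step_functions X) (information_inequality n c A m d B)"
    and "singleton_dominating X h"
  shows "information_inequality n c A m d B h"
  using \<open>singleton_dominating X h\<close>
proof (induction "card {x \<in> X. h {x} \<noteq> 0}" arbitrary: h rule: less_induct)
  case less
  define P where "P = {x \<in> X. h {x} \<noteq> 0}"
  have finP: "finite P" using \<open>finite X\<close> by (simp add: P_def)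
  have nonneg: "h W \<ge> 0" if "W \<subseteq> X" for W
    using less.prems that by (auto simp: singleton_dominating_def)
  show ?case
  proof (cases "P = {}")
    case True
    \<comment> \<open>The right-hand side evaluates \<open>h\<close> only at singletons, so it
      vanishes, while the left-hand side is nonnegative.\<close>
    have "h (B j) = 0" if "j \<in> {1..m}" for j
      using B[OF that] True by (auto simp: P_def is_singleton_def)
    moreover have "(\<Sum>i=1..n. c i * h (A i)) \<ge> 0"
      using c A nonneg by (intro sum_nonneg mult_nonneg_nonneg) auto
    ultimately show ?thesis
      by (simp add: information_inequality_def)
  next
    case False
    \<comment> \<open>The largest multiple of \<open>s\<close> that can be subtracted while all
      singleton values stay nonnegative.\<close>
    define e where "e = Min ((\<lambda>x. h {x}) ` P)"
    define U where "U = {x \<in> X. h {x} = 0}"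
    define s :: "'a set \<Rightarrow> real" where "s = (\<lambda>W. if W \<subseteq> U then 0 else 1)"
    define h' where "h' = (\<lambda>W. h W - e * s W)"
    have e_le: "e \<le> h {x}" if "x \<in> P" for x
      using that finP by (simp add: e_def)
    have "e \<in> (\<lambda>x. h {x}) ` P"
      unfolding e_def using finP False by (intro Min_in) auto
    then obtain p where p: "p \<in> P" "h {p} = e" by auto
    have "e \<ge> 0" using p nonneg[of "{p}"] by (auto simp: P_def)
    have "singleton_dominating X h'"
      unfolding h'_def s_def
      by (rule singleton_dominating_peel[OF less.prems U_def]) (auto intro: e_le simp: P_def U_def)
    \<comment> \<open>Singletons inside \<open>U\<close> keep the value 0, and a minimizer
      \<open>p\<close> drops to 0, so the inclusion is strict.\<close>
    moreover have "{x \<in> X. h' {x} \<noteq> 0} \<subset> P"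
    proof
      show "{x \<in> X. h' {x} \<noteq> 0} \<subseteq> P"
        by (auto simp: h'_def s_def U_def P_def)
      have "h' {p} = 0" using p by (auto simp: h'_def s_def U_def P_def)
      then show "{x \<in> X. h' {x} \<noteq> 0} \<noteq> P" using p by blast
    qed
    ultimately have "information_inequality n c A m d B h'"
      using less.hyps psubset_card_mono[OF finP] by (simp add: P_def)
    moreover have "information_inequality n c A m d B s"
      using valid step_function_in_step_functions[of U X]
      by (auto simp: valid_over_def s_def U_def)
    ultimately have "information_inequality n c A m d B (\<lambda>W. h' W + e * s W)"
      using \<open>e \<ge> 0\<close> by (rule information_inequality_add_scale)
    then show ?thesis by (simp add: h'_def)
  qed
qed

theorem theorem11:
  fixes X :: "'a set"
    and n m :: nat
    and c d :: "nat \<Rightarrow> real"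
    and A B :: "nat \<Rightarrow> 'a set"
  assumes "finite X"
    and "\<And>i. i \<in> {1..n} \<Longrightarrow> c i > 0"
    and "\<And>j. j \<in> {1..m} \<Longrightarrow> d j > 0"
    and "\<And>i. i \<in> {1..n} \<Longrightarrow> A i \<subseteq> X"
    and "\<And>j. j \<in> {1..m} \<Longrightarrow> B j \<subseteq> X"
    and "\<And>j. j \<in> {1..m} \<Longrightarrow> is_singleton (B j)"
  shows "valid_over (step_functions X) (information_inequality n c A m d B) \<longleftrightarrow> valid_over (monotone_functions X) (information_inequality n c A m d B)"
proof
  assume valid: "valid_over (step_functions X) (information_inequality n c A m d B)"
  show "valid_over (monotone_functions X) (information_inequality n c A m d B)"
    unfolding valid_over_def
  proof
    fix h assume "h \<in> monotone_functions X"
    then have "singleton_dominating X h"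
      by (rule monotone_imp_singleton_dominating)
    with assms valid show "information_inequality n c A m d B h"
      by (intro information_inequality_singleton_dominating) (auto intro: less_imp_le)
  qed
next
  assume "valid_over (monotone_functions X) (information_inequality n c A m d B)"
  then show "valid_over (step_functions X) (information_inequality n c A m d B)"
    using step_functions_subset_monotone by (auto simp: valid_over_def)
qed

end
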